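(* Let $R$ be a commutative ring with identity, let $M$ be a Noetherian coreduced comultiplication $R$-module, and let $N_1,\dots,N_n$ be non-zero submodules of $M$ such that $Ann_R(N_i)$ and $Ann_R(N_j)$ are co-prime ideals of $R$ whenever $i\neq j$. Then $\sum_{i=1}^nN_i$ is a $dsz^\circ$-submodule of $M$ if and only if $N_j$ is a $dsz^\circ$-submodule of $M$ for each $1\leq j\leq n$.
   Context: For an ideal $I$ of $R$, $r\in R$ and a submodule $K$ of $M$: $(0:_MI)=\{m\in M: Im=0\}$, $(K:_Mr)=\{m\in M: rm\in K\}$. Ideals $I,J$ are co-prime if $I+J=R$. $M$ is a comultiplication module if every submodule $N$ of $M$ has the form $N=(0:_MI)$ for some ideal $I$ of $R$. A proper submodule $L$ of $M$ is completely irreducible if $L=\bigcap_{i\in I}N_i$ for a family of submodules $N_i$ of $M$ implies $L=N_i$ for some $i$. $M$ is coreduced if for every $r\in R$ and every completely irreducible submodule $L$ of $M$, $(L:_Mr)=M$ implies $L+(0:_Mr)=M$. A non-zero submodule $S$ of $M$ is second if for each $a\in R$ multiplication by $a$ on $S$ is either surjective or zero. A maximal second submodule of $M$ is a second submodule of $M$ that is maximal under inclusion among the second submodules of $M$. For a submodule $K$ of $M$, $\mathfrak{S}_K$ is the sum of all maximal second submodules of $M$ contained in $K$ (and $0$ if there are none). A non-zero submodule $N$ of $M$ is a $dsz^\circ$-submodule of $M$ if $N\subseteq\mathfrak{S}_K$ for every submodule $K$ of $M$ with $N\subseteq K$. *)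

theory Defs
  imports "HOL-Algebra.Module" "HOL-Algebra.Ideal"
begin

definition annihilator :: "('a, 'm) ring_scheme \<Rightarrow> ('a, 'b, 'n) module_scheme \<Rightarrow> 'b set \<Rightarrow> 'a set"
  where "annihilator R M N = {r \<in> carrier R. \<forall>x\<in>N. r \<odot>\<^bsub>M\<^esub> x = \<zero>\<^bsub>M\<^esub>}"

text \<open>\<open>ann_in M I\<close> is \<open>(0 :\<^sub>M I)\<close> and \<open>colon M K r\<close> is \<open>(K :\<^sub>M r)\<close>;
  in particular \<open>colon M {\<zero>\<^bsub>M\<^esub>} r\<close> is \<open>(0 :\<^sub>M r)\<close>.\<close>

definition ann_in :: "('a, 'b, 'n) module_scheme \<Rightarrow> 'a set \<Rightarrow> 'b set"
  where "ann_in M I = {m \<in> carrier M. \<forall>r\<in>I. r \<odot>\<^bsub>M\<^esub> m = \<zero>\<^bsub>M\<^esub>}"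

definition colon :: "('a, 'b, 'n) module_scheme \<Rightarrow> 'b set \<Rightarrow> 'a \<Rightarrow> 'b set"
  where "colon M K r = {m \<in> carrier M. r \<odot>\<^bsub>M\<^esub> m \<in> K}"

definition coprime_ideals :: "('a, 'm) ring_scheme \<Rightarrow> 'a set \<Rightarrow> 'a set \<Rightarrow> bool"
  where "coprime_ideals R I J \<longleftrightarrow> I <+>\<^bsub>R\<^esub> J = carrier R"

text \<open>The sum of a possibly infinite family of submodules: all finite sums of elements of the
  members. It is \<open>{\<zero>\<^bsub>M\<^esub>}\<close> when the index set is empty.\<close>

definition submodule_sum :: "('a, 'b, 'n) module_scheme \<Rightarrow> 'i set \<Rightarrow> ('i \<Rightarrow> 'b set) \<Rightarrow> 'b set"
  where "submodule_sum M I N =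
    {finsum M f T | f T. finite T \<and> T \<subseteq> I \<and> (\<forall>i\<in>T. f i \<in> N i)}"

definition noetherian_module :: "('a, 'm) ring_scheme \<Rightarrow> ('a, 'b, 'n) module_scheme \<Rightarrow> bool"
  where "noetherian_module R M \<longleftrightarrow> module R M \<and>
    (\<forall>C :: nat \<Rightarrow> 'b set. (\<forall>k. submodule (C k) R M) \<and> (\<forall>k. C k \<subseteq> C (Suc k))
      \<longrightarrow> (\<exists>k. \<forall>l\<ge>k. C l = C k))"

definition comultiplication_module :: "('a, 'm) ring_scheme \<Rightarrow> ('a, 'b, 'n) module_scheme \<Rightarrow> bool"
  where "comultiplication_module R M \<longleftrightarrow> module R M \<and>
    (\<forall>N. submodule N R M \<longrightarrow> (\<exists>I. ideal I R \<and> N = ann_in M I))"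

text \<open>Intersecting with \<open>carrier M\<close> makes the intersection of the empty family equal to \<open>M\<close>.\<close>

definition completely_irreducible ::
    "('a, 'm) ring_scheme \<Rightarrow> ('a, 'b, 'n) module_scheme \<Rightarrow> 'b set \<Rightarrow> bool"
  where "completely_irreducible R M L \<longleftrightarrow> submodule L R M \<and> L \<noteq> carrier M \<and>
    (\<forall>F. (\<forall>N\<in>F. submodule N R M) \<and> L = carrier M \<inter> \<Inter>F \<longrightarrow> L \<in> F)"

definition coreduced_module :: "('a, 'm) ring_scheme \<Rightarrow> ('a, 'b, 'n) module_scheme \<Rightarrow> bool"
  where "coreduced_module R M \<longleftrightarrow> module R M \<and>
    (\<forall>r\<in>carrier R. \<forall>L. completely_irreducible R M L \<and> colon M L r = carrier M
      \<longrightarrow> L <+>\<^bsub>M\<^esub> colon M {\<zero>\<^bsub>M\<^esub>} r = carrier M)"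

definition second_submodule ::
    "('a, 'm) ring_scheme \<Rightarrow> ('a, 'b, 'n) module_scheme \<Rightarrow> 'b set \<Rightarrow> bool"
  where "second_submodule R M S \<longleftrightarrow> submodule S R M \<and> S \<noteq> {\<zero>\<^bsub>M\<^esub>} \<and>
    (\<forall>a\<in>carrier R. (\<lambda>x. a \<odot>\<^bsub>M\<^esub> x) ` S = S \<or> (\<lambda>x. a \<odot>\<^bsub>M\<^esub> x) ` S = {\<zero>\<^bsub>M\<^esub>})"

definition maximal_second_submodule ::
    "('a, 'm) ring_scheme \<Rightarrow> ('a, 'b, 'n) module_scheme \<Rightarrow> 'b set \<Rightarrow> bool"
  where "maximal_second_submodule R M S \<longleftrightarrow> second_submodule R M S \<and>
    (\<forall>S'. second_submodule R M S' \<and> S \<subseteq> S' \<longrightarrow> S' = S)"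

text \<open>\<open>sum_max_second R M K\<close> is \<open>\<SS>\<^sub>K\<close>; maximality is among all second submodules of \<open>M\<close>,
  not just those contained in \<open>K\<close>.\<close>

definition sum_max_second ::
    "('a, 'm) ring_scheme \<Rightarrow> ('a, 'b, 'n) module_scheme \<Rightarrow> 'b set \<Rightarrow> 'b set"
  where "sum_max_second R M K =
    submodule_sum M {S. maximal_second_submodule R M S \<and> S \<subseteq> K} (\<lambda>S. S)"

definition dsz_submodule ::
    "('a, 'm) ring_scheme \<Rightarrow> ('a, 'b, 'n) module_scheme \<Rightarrow> 'b set \<Rightarrow> bool"
  where "dsz_submodule R M N \<longleftrightarrow> submodule N R M \<and> N \<noteq> {\<zero>\<^bsub>M\<^esub>} \<and>
    (\<forall>K. submodule K R M \<and> N \<subseteq> K \<longrightarrow> N \<subseteq> sum_max_second R M K)"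

end

theory Submission
  imports Defs
begin

text \<open>Only the direction from the sum to a summand needs an idea. Coprimality of the annihilators
  yields a scalar \<open>b\<close> that acts as the identity on \<open>N\<^sub>j\<close> and kills every other \<open>N\<^sub>i\<close>. If
  \<open>N\<^sub>j \<subseteq> K\<close> then \<open>(K :\<^sub>M b)\<close> contains the whole sum, so each \<open>x \<in> N\<^sub>j\<close> is a finite sum of elements
  \<open>s\<close> of maximal second submodules \<open>S\<close> with \<open>b S \<subseteq> K\<close>. Then \<open>x = b x\<close> is the sum of the \<open>b s\<close>, and
  since \<open>b S\<close> is \<open>S\<close> or \<open>0\<close>, only those \<open>S\<close> that lie in \<open>K\<close> contribute.\<close>

context module
begin

section \<open>Sums of families of submodules\<close>

lemma submodule_zero: "submodule H R M \<Longrightarrow> \<zero>\<^bsub>M\<^esub> \<in> H"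
  using subgroup.one_closed[OF submodule.axioms(1)] by fastforce

lemma finsum_in_submodule:
  assumes H: "submodule H R M" and "finite T" "\<And>i. i \<in> T \<Longrightarrow> f i \<in> H"
  shows "finsum M f T \<in> H"
  using assms(2,3)
proof (induction T)
  case empty
  then show ?case using submodule_zero[OF H] by simp
next
  case (insert i T)
  then have "f \<in> T \<rightarrow> carrier M" "f i \<in> carrier M"
    using submoduleE(1)[OF H] by auto
  then show ?case
    using insert submoduleE(5)[OF H] by simp
qed

lemma submodule_sum_subset:
  assumes "submodule H R M" and "\<And>i. i \<in> I \<Longrightarrow> N i \<subseteq> H"
  shows "submodule_sum M I N \<subseteq> H"
  using assms unfolding submodule_sum_def by (fastforce intro: finsum_in_submodule)

lemma subset_submodule_sum:
  assumes "submodule (N i) R M" and "i \<in> I"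
  shows "N i \<subseteq> submodule_sum M I N"
proof
  fix x assume x: "x \<in> N i"
  then have "finsum M (\<lambda>_. x) {i} = x"
    using submoduleE(1)[OF assms(1)] by (auto simp: finsum_insert)
  then show "x \<in> submodule_sum M I N"
    using x assms(2) unfolding submodule_sum_def
    by (intro CollectI exI[of _ "\<lambda>_. x"] exI[of _ "{i}"]) auto
qed

lemma submodule_sum_submodule:
  assumes N: "\<And>i. i \<in> I \<Longrightarrow> submodule (N i) R M"
  shows "submodule (submodule_sum M I N) R M"
proof -
  let ?S = "submodule_sum M I N"
  have sumI: "finsum M f T \<in> ?S" if "finite T" "T \<subseteq> I" "\<And>i. i \<in> T \<Longrightarrow> f i \<in> N i" for f T
    using that unfolding submodule_sum_def by auto
  have car: "f \<in> T \<rightarrow> carrier M" if "T \<subseteq> I" "\<forall>i\<in>T. f i \<in> N i" for f T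
    using that submoduleE(1)[OF N] by blast
  have smult: "r \<odot>\<^bsub>M\<^esub> x \<in> ?S" if r: "r \<in> carrier R" and x: "x \<in> ?S" for r x
  proof -
    obtain f T where T: "finite T" "T \<subseteq> I" "\<forall>i\<in>T. f i \<in> N i" and xf: "x = finsum M f T"
      using x unfolding submodule_sum_def by blast
    have "r \<odot>\<^bsub>M\<^esub> x = finsum M (\<lambda>i. r \<odot>\<^bsub>M\<^esub> f i) T"
      unfolding xf using T r car by (intro finsum_smult_ldistr) auto
    also have "\<dots> \<in> ?S"
      using T r submoduleE(4)[OF N] by (intro sumI) auto
    finally show ?thesis .
  qed
  have sub: "?S \<subseteq> carrier M"
    using N submoduleE(1) by (intro submodule_sum_subset carrier_is_submodule) blast
  show ?thesis
  proof (rule submoduleI[OF sub])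
    show "\<zero>\<^bsub>M\<^esub> \<in> ?S" using sumI[of "{}"] by simp
  next
    fix x assume x: "x \<in> ?S"
    \<comment> \<open>Writing -x as (-1)x reduces closure under negation to closure under
      scalars.\<close>
    then have "\<ominus>\<^bsub>M\<^esub> x = (\<ominus> \<one>) \<odot>\<^bsub>M\<^esub> x"
      using sub by (auto simp: smult_l_minus)
    then show "\<ominus>\<^bsub>M\<^esub> x \<in> ?S" using smult[OF _ x] by simp
  next
    fix x y assume "x \<in> ?S" "y \<in> ?S"
    then obtain f T g U
      where T: "finite T" "T \<subseteq> I" "\<forall>i\<in>T. f i \<in> N i" and x: "x = finsum M f T"
        and U: "finite U" "U \<subseteq> I" "\<forall>i\<in>U. g i \<in> N i" and y: "y = finsum M g U"
      unfolding submodule_sum_def by blast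
    \<comment> \<open>The two finite sums may run over different index sets. Padding both families
      with zero, which lies in every \<open>N i\<close>, puts them over \<open>T \<union> U\<close>,
      where they can be added term by term.\<close>
    define f' where "f' i = (if i \<in> T then f i else \<zero>\<^bsub>M\<^esub>)" for i
    define g' where "g' i = (if i \<in> U then g i else \<zero>\<^bsub>M\<^esub>)" for i
    have f': "\<forall>i\<in>T \<union> U. f' i \<in> N i" and g': "\<forall>i\<in>T \<union> U. g' i \<in> N i"
      using T U submodule_zero[OF N] unfolding f'_def g'_def by auto
    have car': "f' \<in> T \<union> U \<rightarrow> carrier M" "g' \<in> T \<union> U \<rightarrow> carrier M"
      using car[OF _ f'] car[OF _ g'] T U by auto
    have "x = finsum M f' (T \<union> U)"
      unfolding x by (rule M.add.finprod_mono_neutral_cong_left)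
        (use T U car' in \<open>auto simp: f'_def\<close>)
    moreover have "y = finsum M g' (T \<union> U)"
      unfolding y by (rule M.add.finprod_mono_neutral_cong_left)
        (use T U car' in \<open>auto simp: g'_def\<close>)
    ultimately have "x \<oplus>\<^bsub>M\<^esub> y = finsum M (\<lambda>i. f' i \<oplus>\<^bsub>M\<^esub> g' i) (T \<union> U)"
      using car' by (simp add: M.finsum_addf)
    also have "\<dots> \<in> ?S"
      using T U f' g' submoduleE(5)[OF N] by (intro sumI) auto
    finally show "x \<oplus>\<^bsub>M\<^esub> y \<in> ?S" .
  qed (use smult in auto)
qed

lemma sum_max_second_submodule: "submodule (sum_max_second R M K) R M"
  unfolding sum_max_second_def
  by (rule submodule_sum_submodule) (simp add: maximal_second_submodule_def second_submodule_def)

section \<open>Colon submodules and multiplication by a separating scalar\<close>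

lemma submodule_colon:
  assumes K: "submodule K R M" and b: "b \<in> carrier R"
  shows "submodule (colon M K b) R M"
proof (rule submoduleI)
  fix a x assume "a \<in> carrier R" "x \<in> colon M K b"
  moreover from this have "b \<odot>\<^bsub>M\<^esub> (a \<odot>\<^bsub>M\<^esub> x) = a \<odot>\<^bsub>M\<^esub> (b \<odot>\<^bsub>M\<^esub> x)"
    using b by (simp add: colon_def R.m_comm flip: smult_assoc1)
  ultimately show "a \<odot>\<^bsub>M\<^esub> x \<in> colon M K b"
    using submoduleE(4)[OF K] by (simp add: colon_def)
qed (use b submodule_zero[OF K] submoduleE(3,5)[OF K]
      in \<open>auto simp: colon_def smult_r_minus smult_r_distr\<close>)

lemma smult_eq_self_of_add_annihilator:
  assumes "a \<in> annihilator R M L" "c \<in> carrier R" "a \<oplus> c = \<one>" "L \<subseteq> carrier M" "x \<in> L"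
  shows "c \<odot>\<^bsub>M\<^esub> x = x"
proof -
  have "a \<in> carrier R" "a \<odot>\<^bsub>M\<^esub> x = \<zero>\<^bsub>M\<^esub>" "x \<in> carrier M"
    using assms by (auto simp: annihilator_def)
  then have "(a \<oplus> c) \<odot>\<^bsub>M\<^esub> x = c \<odot>\<^bsub>M\<^esub> x"
    using assms(2) by (simp add: smult_l_distr)
  then show ?thesis
    using \<open>x \<in> carrier M\<close> assms(3) by simp
qed

text \<open>For each \<open>i\<close>, coprimality splits 1 as a + c with a killing \<open>L\<close>
  and c killing \<open>N i\<close>; then c fixes \<open>L\<close> pointwise. The product of these c
  over \<open>T\<close> still fixes \<open>L\<close> and kills every \<open>N i\<close>. This is the
  usual argument that an ideal coprime to finitely many ideals is coprime to their product.\<close>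

lemma coprime_separating_scalar:
  assumes "finite T" and L: "L \<subseteq> carrier M"
    and "\<And>i. i \<in> T \<Longrightarrow> N i \<subseteq> carrier M"
    and "\<And>i. i \<in> T \<Longrightarrow> coprime_ideals R (annihilator R M L) (annihilator R M (N i))"
  shows "\<exists>b\<in>carrier R. (\<forall>x\<in>L. b \<odot>\<^bsub>M\<^esub> x = x) \<and> (\<forall>i\<in>T. \<forall>y\<in>N i. b \<odot>\<^bsub>M\<^esub> y = \<zero>\<^bsub>M\<^esub>)"
  using assms(1,3,4)
proof (induction T)
  case empty
  then show ?case using L by (intro bexI[of _ \<one>]) auto
next
  case (insert i T)
  have "\<exists>b\<in>carrier R. (\<forall>x\<in>L. b \<odot>\<^bsub>M\<^esub> x = x) \<and> (\<forall>k\<in>T. \<forall>y\<in>N k. b \<odot>\<^bsub>M\<^esub> y = \<zero>\<^bsub>M\<^esub>)"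
    using insert.prems by (intro insert.IH) simp_all
  then obtain b where b: "b \<in> carrier R" "\<forall>x\<in>L. b \<odot>\<^bsub>M\<^esub> x = x"
    and bT: "\<forall>k\<in>T. \<forall>y\<in>N k. b \<odot>\<^bsub>M\<^esub> y = \<zero>\<^bsub>M\<^esub>"
    by blast
  have "\<one> \<in> annihilator R M L <+> annihilator R M (N i)"
    using insert.prems(2)[of i] by (simp add: coprime_ideals_def)
  then obtain a c where a: "a \<in> annihilator R M L" and c: "c \<in> annihilator R M (N i)"
    and ac: "\<one> = a \<oplus> c"
    unfolding set_add_def' by blast
  have cR: "c \<in> carrier R" using c by (simp add: annihilator_def)
  have cL: "c \<odot>\<^bsub>M\<^esub> x = x" if "x \<in> L" for x
    using smult_eq_self_of_add_annihilator[OF a cR ac[symmetric] L that] .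
  show ?case
  proof (intro bexI conjI ballI)
    show "b \<otimes> c \<in> carrier R" using b cR by simp
    show "(b \<otimes> c) \<odot>\<^bsub>M\<^esub> x = x" if "x \<in> L" for x
      using that b cR cL L by (simp add: smult_assoc1 subsetD)
    fix k y assume k: "k \<in> insert i T" and y: "y \<in> N k"
    have yM: "y \<in> carrier M" using insert.prems(1)[OF k] y by (rule subsetD)
    show "(b \<otimes> c) \<odot>\<^bsub>M\<^esub> y = \<zero>\<^bsub>M\<^esub>"
    proof (cases "k = i")
      case True
      then show ?thesis using y yM c b cR by (simp add: smult_assoc1 annihilator_def)
    next
      case False
      then have by0: "b \<odot>\<^bsub>M\<^esub> y = \<zero>\<^bsub>M\<^esub>" using k y bT by simp
      \<comment> \<open>For the earlier indices it is \<open>b\<close> that kills \<open>y\<close>,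
        so the factors are swapped to let \<open>b\<close> act first.\<close>
      have "(b \<otimes> c) \<odot>\<^bsub>M\<^esub> y = c \<odot>\<^bsub>M\<^esub> (b \<odot>\<^bsub>M\<^esub> y)"
        using R.m_comm[OF b(1) cR] smult_assoc1[OF cR b(1) yM] by simp
      then show ?thesis using by0 cR by simp
    qed
  qed
qed

text \<open>Multiplication by \<open>b\<close> acts on each summand \<open>S\<close> separately, and
  secondness leaves only two cases: bS = S or bS = 0. Maximality refers to all second submodules of
  \<open>M\<close>, so it is unaffected when the ambient submodule changes from
  \<open>colon M K b\<close> to \<open>K\<close>; only the inclusion in \<open>K\<close> has to be
  checked.\<close>

lemma smult_sum_max_second_colon:
  assumes b: "b \<in> carrier R" and x: "x \<in> sum_max_second R M (colon M K b)"
  shows "b \<odot>\<^bsub>M\<^esub> x \<in> sum_max_second R M K"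
proof -
  obtain f T where T: "finite T"
      "T \<subseteq> {S. maximal_second_submodule R M S \<and> S \<subseteq> colon M K b}"
      "\<forall>S\<in>T. f S \<in> S"
    and xf: "x = finsum M f T"
    using x unfolding sum_max_second_def submodule_sum_def by blast
  have sub: "submodule S R M" if "maximal_second_submodule R M S" for S
    using that by (simp add: maximal_second_submodule_def second_submodule_def)
  have fM: "f \<in> T \<rightarrow> carrier M"
    using T submoduleE(1)[OF sub] by blast
  have "b \<odot>\<^bsub>M\<^esub> x = finsum M (\<lambda>S. b \<odot>\<^bsub>M\<^esub> f S) T"
    unfolding xf using T(1) b fM by (rule finsum_smult_ldistr)
  also have "\<dots> \<in> sum_max_second R M K"
  proof (rule finsum_in_submodule[OF sum_max_second_submodule T(1)])
    fix S assume "S \<in> T"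
    then have S: "maximal_second_submodule R M S" "S \<subseteq> colon M K b" "f S \<in> S"
      using T by auto
    then consider "(\<lambda>y. b \<odot>\<^bsub>M\<^esub> y) ` S = S" | "(\<lambda>y. b \<odot>\<^bsub>M\<^esub> y) ` S = {\<zero>\<^bsub>M\<^esub>}"
      using b unfolding maximal_second_submodule_def second_submodule_def by blast
    then show "b \<odot>\<^bsub>M\<^esub> f S \<in> sum_max_second R M K"
    proof cases
      case 1
      \<comment> \<open>Since S = bS here, the inclusion of bS in \<open>K\<close> makes
        \<open>S\<close> itself one of the summands for \<open>K\<close>.\<close>
      moreover have "(\<lambda>y. b \<odot>\<^bsub>M\<^esub> y) ` S \<subseteq> K" using S(2) by (auto simp: colon_def)
      ultimately have "S \<subseteq> K" by simp
      then have "S \<subseteq> sum_max_second R M K"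
        unfolding sum_max_second_def
        using S sub by (intro subset_submodule_sum[where N = "\<lambda>S. S"]) auto
      then show ?thesis using 1 S(3) by blast
    next
      case 2
      then have "b \<odot>\<^bsub>M\<^esub> f S = \<zero>\<^bsub>M\<^esub>" using S(3) by blast
      then show ?thesis using submodule_zero[OF sum_max_second_submodule] by simp
    qed
  qed
  finally show ?thesis .
qed

section \<open>The two implications\<close>

lemma dsz_submodule_summand:
  assumes fin: "finite I" and j: "j \<in> I"
    and N: "\<And>i. i \<in> I \<Longrightarrow> submodule (N i) R M" and nz: "N j \<noteq> {\<zero>\<^bsub>M\<^esub>}"
    and cop: "\<And>i. i \<in> I \<Longrightarrow> i \<noteq> j \<Longrightarrow>
      coprime_ideals R (annihilator R M (N j)) (annihilator R M (N i))"
    and dsz: "dsz_submodule R M (submodule_sum M I N)"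
  shows "dsz_submodule R M (N j)"
  unfolding dsz_submodule_def
proof (intro conjI allI impI)
  fix K assume K: "submodule K R M \<and> N j \<subseteq> K"
  have NM: "N i \<subseteq> carrier M" if "i \<in> I" for i using submoduleE(1)[OF N[OF that]] .
  obtain b where b: "b \<in> carrier R" "\<forall>x\<in>N j. b \<odot>\<^bsub>M\<^esub> x = x"
    and b0: "\<forall>i\<in>I - {j}. \<forall>y\<in>N i. b \<odot>\<^bsub>M\<^esub> y = \<zero>\<^bsub>M\<^esub>"
    using coprime_separating_scalar[of "I - {j}" "N j" N] fin j NM cop by auto
  have colon: "submodule (colon M K b) R M" using K b by (simp add: submodule_colon)
  \<comment> \<open>For i = j this holds because \<open>b\<close> fixes \<open>N j\<close>, which
    lies in \<open>K\<close>; for the other indices, because \<open>b\<close> maps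
    \<open>N i\<close> to zero.\<close>
  have "N i \<subseteq> colon M K b" if "i \<in> I" for i
    using that b b0 K NM[OF that] submodule_zero[of K]
    by (cases "i = j") (auto simp: colon_def subset_iff)
  then have "submodule_sum M I N \<subseteq> colon M K b"
    by (rule submodule_sum_subset[OF colon])
  \<comment> \<open>The hypothesis on the sum cannot be applied to \<open>K\<close>, which need not
    contain the other summands; it is applied to the colon submodule instead.\<close>
  then have "submodule_sum M I N \<subseteq> sum_max_second R M (colon M K b)"
    using dsz colon by (simp add: dsz_submodule_def)
  then have sub: "N j \<subseteq> sum_max_second R M (colon M K b)"
    using subset_submodule_sum[of N j, OF N[OF j] j] by blast
  show "N j \<subseteq> sum_max_second R M K"
  proof
    fix x assume "x \<in> N j"
    then show "x \<in> sum_max_second R M K"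
      using smult_sum_max_second_colon[OF b(1), of x K] sub b(2) by auto
  qed
qed (use N j nz in auto)

text \<open>A submodule \<open>K\<close> containing the sum contains every \<open>N i\<close>, so
  each \<open>N i\<close> lies in \<open>sum_max_second R M K\<close>. The latter is a submodule and
  hence contains their sum. Any single \<open>N i\<close> shows that the sum is non-zero; the empty
  sum would be zero.\<close>

lemma dsz_submodule_sum:
  assumes "I \<noteq> {}" and dsz: "\<And>i. i \<in> I \<Longrightarrow> dsz_submodule R M (N i)"
  shows "dsz_submodule R M (submodule_sum M I N)"
proof -
  have N: "submodule (N i) R M" if "i \<in> I" for i
    using dsz[OF that] by (simp add: dsz_submodule_def)
  obtain i where i: "i \<in> I" using assms(1) by blast
  have le: "N i \<subseteq> submodule_sum M I N" if "i \<in> I" for i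
    using subset_submodule_sum[of N, OF N[OF that] that] .
  have "submodule_sum M I N \<noteq> {\<zero>\<^bsub>M\<^esub>}"
    using le[OF i] dsz[OF i] submodule_zero[OF N[OF i]] by (auto simp: dsz_submodule_def)
  moreover have "submodule_sum M I N \<subseteq> sum_max_second R M K"
    if "submodule K R M" "submodule_sum M I N \<subseteq> K" for K
  proof (rule submodule_sum_subset[OF sum_max_second_submodule])
    fix i assume i: "i \<in> I"
    then have "N i \<subseteq> K" using le that(2) by blast
    then show "N i \<subseteq> sum_max_second R M K"
      using dsz[OF i] that(1) by (simp add: dsz_submodule_def)
  qed
  ultimately show ?thesis
    using submodule_sum_submodule[of I N, OF N] by (simp add: dsz_submodule_def)
qed

end

theorem theorem3p16:
  fixes R :: "('a, 'm) ring_scheme"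
    and M :: "('a, 'b, 'n) module_scheme"
    and N :: "nat \<Rightarrow> 'b set"
    and n :: nat
  assumes "cring R"
    and "module R M"
    and "noetherian_module R M"
    and "coreduced_module R M"
    and "comultiplication_module R M"
    and "n \<ge> 1"
    and "\<And>i. i \<in> {1..n} \<Longrightarrow> submodule (N i) R M \<and> N i \<noteq> {\<zero>\<^bsub>M\<^esub>}"
    and "\<And>i j. i \<in> {1..n} \<Longrightarrow> j \<in> {1..n} \<Longrightarrow> i \<noteq> j \<Longrightarrow>
      coprime_ideals R (annihilator R M (N i)) (annihilator R M (N j))"
  shows "dsz_submodule R M (submodule_sum M {1..n} N) \<longleftrightarrow>
    (\<forall>j\<in>{1..n}. dsz_submodule R M (N j))"
proof -
  interpret module R M by (rule assms(2))
  show ?thesis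
  proof
    assume dsz: "dsz_submodule R M (submodule_sum M {1..n} N)"
    show "\<forall>j\<in>{1..n}. dsz_submodule R M (N j)"
    proof
      fix j assume j: "j \<in> {1..n}"
      show "dsz_submodule R M (N j)"
        by (rule dsz_submodule_summand[OF _ j _ _ _ dsz]) (use assms(7,8) j in auto)
    qed
  next
    assume "\<forall>j\<in>{1..n}. dsz_submodule R M (N j)"
    \<comment> \<open>The bound \<open>n \<ge> 1\<close> makes the index set non-empty.\<close>
    then show "dsz_submodule R M (submodule_sum M {1..n} N)"
      using assms(6) by (intro dsz_submodule_sum[of "{1..n}" N]) auto
  qed
qed

end
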